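(* Let $(E,\mathcal{F})$ be a $p$-system (with $p\ge 1$) on a finite set $E$, and let $f:2^E\to\mathbb{R}_{\ge 0}$ be a monotone (non-decreasing) submodular function with curvature $\kappa\in[0,1]$. Then the greedy algorithm for maximizing $f$ over $(E,\mathcal{F})$ has approximation factor $\frac{1}{p+\kappa}$; that is, if $S$ is the output of the greedy algorithm, then $S\in\mathcal{F}$ and $$f(S)\ \ge\ \frac{1}{p+\kappa}\,\max_{A\in\mathcal{F}} f(A).$$
   Context: An independence system $(E,\mathcal{F})$ is a finite set $E$ together with a nonempty family $\mathcal{F}\subseteq 2^E$ closed under taking subsets; members of $\mathcal{F}$ are called independent. For $A\subseteq E$, a basis of $A$ is an inclusion-maximal independent subset of $A$. Let $U(A)$ and $L(A)$ be the maximum and minimum cardinality of a basis of $A$. The system is a $p$-system if $U(A)\le p\,L(A)$ for all $A\subseteq E$. A function $f:2^E\to\mathbb{R}$ is submodular if $f(S)+f(T)\ge f(S\cup T)+f(S\cap T)$ for all $S,T\subseteq E$. Write $\Delta_A(e)=f(A\cup\{e\})-f(A)$ and $f(e)=f(\{e\})$. The function $f$ has curvature $\kappa\in[0,1]$ if $\Delta_A(e)\ge(1-\kappa)f(e)$ for every $A\subset E$ and every $e\in E\setminus A$. Greedy algorithm: start with $S=\emptyset$ and $N=E$. While $N\neq\emptyset$ and $S$ is not maximal in $\mathcal{F}$: choose $m\in N$ maximizing $\Delta_S(m)$ (ties broken arbitrarily); if $S\cup\{m\}\in\mathcal{F}$ replace $S$ by $S\cup\{m\}$; remove $m$ from $N$.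 Output $S$. *)

theory Defs
  imports Complex_Main
begin

definition indep_system :: "'a set \<Rightarrow> 'a set set \<Rightarrow> bool" where
  "indep_system E F \<longleftrightarrow>
     finite E \<and> F \<noteq> {} \<and> F \<subseteq> Pow E \<and> (\<forall>A\<in>F. \<forall>B. B \<subseteq> A \<longrightarrow> B \<in> F)"

definition basis_of :: "'a set set \<Rightarrow> 'a set \<Rightarrow> 'a set \<Rightarrow> bool" where
  "basis_of F A B \<longleftrightarrow> B \<in> F \<and> B \<subseteq> A \<and> \<not> (\<exists>C\<in>F. C \<subseteq> A \<and> B \<subset> C)"

definition upper_rank :: "'a set set \<Rightarrow> 'a set \<Rightarrow> nat" where
  "upper_rank F A = Max (card ` {B. basis_of F A B})"

definition lower_rank :: "'a set set \<Rightarrow> 'a set \<Rightarrow> nat" where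
  "lower_rank F A = Min (card ` {B. basis_of F A B})"

definition p_system :: "real \<Rightarrow> 'a set \<Rightarrow> 'a set set \<Rightarrow> bool" where
  "p_system p E F \<longleftrightarrow> indep_system E F \<and>
     (\<forall>A. A \<subseteq> E \<longrightarrow> real (upper_rank F A) \<le> p * real (lower_rank F A))"

definition submodular_on :: "'a set \<Rightarrow> ('a set \<Rightarrow> real) \<Rightarrow> bool" where
  "submodular_on E f \<longleftrightarrow>
     (\<forall>S T. S \<subseteq> E \<longrightarrow> T \<subseteq> E \<longrightarrow> f S + f T \<ge> f (S \<union> T) + f (S \<inter> T))"

definition marginal :: "('a set \<Rightarrow> real) \<Rightarrow> 'a set \<Rightarrow> 'a \<Rightarrow> real" where
  "marginal f A e = f (A \<union> {e}) - f A"

text \<open>As \<^term>\<open>f {}\<close> need not vanish, \<^term>\<open>f {e}\<close> below is in general not the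
  marginal value of \<^term>\<open>e\<close> at the empty set.\<close>

definition has_curvature :: "'a set \<Rightarrow> ('a set \<Rightarrow> real) \<Rightarrow> real \<Rightarrow> bool" where
  "has_curvature E f \<kappa> \<longleftrightarrow> 0 \<le> \<kappa> \<and> \<kappa> \<le> 1 \<and>
     (\<forall>A e. A \<subseteq> E \<longrightarrow> e \<in> E - A \<longrightarrow> marginal f A e \<ge> (1 - \<kappa>) * f {e})"

definition maximal_in :: "'a set set \<Rightarrow> 'a set \<Rightarrow> bool" where
  "maximal_in F S \<longleftrightarrow> S \<in> F \<and> \<not> (\<exists>T\<in>F. S \<subset> T)"

text \<open>States are pairs \<^term>\<open>(S, N)\<close> of the current solution and the set of elements not
  yet examined. Any maximizer may be examined, so every way of breaking ties is covered.\<close>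

inductive greedy_step ::
    "'a set set \<Rightarrow> ('a set \<Rightarrow> real) \<Rightarrow> 'a set \<times> 'a set \<Rightarrow> 'a set \<times> 'a set \<Rightarrow> bool"
  for F f where
  "\<lbrakk>N \<noteq> {}; \<not> maximal_in F S; m \<in> N; is_arg_max (marginal f S) (\<lambda>x. x \<in> N) m\<rbrakk>
   \<Longrightarrow> greedy_step F f (S, N) (if S \<union> {m} \<in> F then S \<union> {m} else S, N - {m})"

definition greedy_output ::
    "'a set \<Rightarrow> 'a set set \<Rightarrow> ('a set \<Rightarrow> real) \<Rightarrow> 'a set \<Rightarrow> bool" where
  "greedy_output E F f S \<longleftrightarrow>
     (\<exists>N. (greedy_step F f)\<^sup>*\<^sup>* ({}, E) (S, N) \<and> (N = {} \<or> maximal_in F S))"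

end

theory Submission
  imports Defs
begin

text \<open>
  Give every examined element the weight \<open>w e\<close> that is its marginal value at the moment it is
  examined. Since the solution only grows and the pool of candidates only shrinks, submodularity
  makes these weights non-increasing in the order of examination. The run is therefore the ordinary
  greedy algorithm for the linear objective \<open>w\<close>: at each moment the current solution is a basis of
  the set of examined elements, so an independent set \<open>Q\<close> has among them at most \<open>p\<close> times as many
  elements as the solution (\<open>p_system_card_le\<close>), and Abel summation over the decreasing weights
  gives \<open>w(Q) \<le> p * w(S)\<close>. The invariant \<open>greedy_certificate\<close> carries this summation along the run
  (\<open>certificate_step\<close>).

  It remains to get back from \<open>w\<close> to \<open>f\<close>. The weights of \<open>S\<close> telescope to \<open>f S - f {}\<close>. Growing
  \<open>S\<close> to \<open>S \<union> Q\<close> gains at most \<open>w(Q - S)\<close>, while by curvature growing \<open>Q\<close> to \<open>S \<union> Q\<close> gains at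
  least \<open>(1 - \<kappa>) * w(S - Q)\<close>. Comparing the two,
  \<open>f Q \<le> f S + w(Q - S) - (1 - \<kappa>) * w(S - Q)\<close>
  \<open>    \<le> f S - (1 - \<kappa>) * w(S) + w(Q) \<le> (p + \<kappa>) * f S\<close>,
  where the last inequality uses \<open>w(Q) \<le> p * w(S)\<close> and \<open>f {} \<ge> 0\<close> (\<open>certificate_bound\<close>).
\<close>

section \<open>Independence systems\<close>

text \<open>
  This is why rejected elements can be forgotten: independence is hereditary, so an element that
  cannot be added now can never be added later.
\<close>

lemma basis_of_insert:
  assumes sub: "\<And>A B. A \<in> F \<Longrightarrow> B \<subseteq> A \<Longrightarrow> B \<in> F"
    and "basis_of F P S" and "m \<notin> P"
  shows "basis_of F (insert m P) (if S \<union> {m} \<in> F then S \<union> {m} else S)"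
proof -
  have S: "S \<in> F" "S \<subseteq> P" and max: "\<And>C. C \<in> F \<Longrightarrow> C \<subseteq> P \<Longrightarrow> \<not> S \<subset> C"
    using assms(2) unfolding basis_of_def by blast+
  show ?thesis
  proof (cases "S \<union> {m} \<in> F")
    case True
    have False if "C \<in> F" "C \<subseteq> insert m P" "S \<union> {m} \<subset> C" for C
    proof -
      have "C - {m} \<in> F" using sub that by blast
      moreover have "C - {m} \<subseteq> P" "S \<subset> C - {m}" using that S assms(3) by blast+
      ultimately show False using max by blast
    qed
    then show ?thesis using True S unfolding basis_of_def by auto
  next
    case False
    have False if "C \<in> F" "C \<subseteq> insert m P" "S \<subset> C" for C
    proof (cases "m \<in> C")
      case True
      then have "S \<union> {m} \<subseteq> C" using that by blast
      then show False using sub that(1) \<open>S \<union> {m} \<notin> F\<close> by blast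
    next
      case False
      then show False using max that by blast
    qed
    then show ?thesis using False S unfolding basis_of_def by auto
  qed
qed

lemma indep_extends_to_basis:
  assumes "finite E" "F \<subseteq> Pow E" "Q \<in> F" "Q \<subseteq> A"
  obtains C where "basis_of F A C" "Q \<subseteq> C"
proof -
  have "finite {B \<in> F. B \<subseteq> A}"
    using assms(1,2) by (simp add: finite_subset)
  moreover have "Q \<in> {B \<in> F. B \<subseteq> A}" using assms(3,4) by simp
  ultimately have "\<exists>C\<in>{B \<in> F. B \<subseteq> A}. Q \<subseteq> C \<and> (\<forall>B\<in>{B \<in> F. B \<subseteq> A}. C \<subseteq> B \<longrightarrow> C = B)"
    by (rule finite_has_maximal2)
  then obtain C where C: "C \<in> F" "C \<subseteq> A" "Q \<subseteq> C"
      and max: "\<forall>B\<in>{B \<in> F. B \<subseteq> A}. C \<subseteq> B \<longrightarrow> C = B"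
    by (elim bexE conjE CollectE)
  have "basis_of F A C"
    unfolding basis_of_def
  proof (intro conjI notI C(1,2))
    assume "\<exists>B\<in>F. B \<subseteq> A \<and> C \<subset> B"
    then obtain B where "B \<in> F" "B \<subseteq> A" "C \<subset> B" by (elim bexE conjE)
    then show False using max[rule_format, of B] by (simp add: psubset_eq)
  qed
  then show ?thesis using C(3) by (rule that)
qed

lemma p_system_card_le:
  assumes ps: "p_system p E F" and "p \<ge> 0" and "A \<subseteq> E"
    and Q: "Q \<in> F" "Q \<subseteq> A" and B: "basis_of F A B"
  shows "real (card Q) \<le> p * real (card B)"
proof -
  have E: "finite E" "F \<subseteq> Pow E" using ps unfolding p_system_def indep_system_def by auto
  have fin: "finite (card ` {B. basis_of F A B})"
    using E by (simp add: basis_of_def finite_subset)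
  obtain C where C: "basis_of F A C" "Q \<subseteq> C"
    using indep_extends_to_basis[OF E Q] by blast
  have "finite C"
    using C(1) E by (intro finite_subset[of C E]) (auto simp: basis_of_def)
  then have "card Q \<le> card C" using C by (simp add: card_mono)
  also have "\<dots> \<le> upper_rank F A"
    unfolding upper_rank_def using fin C by (intro Max_ge) auto
  finally have "real (card Q) \<le> real (upper_rank F A)" by simp
  also have "\<dots> \<le> p * real (lower_rank F A)" using ps \<open>A \<subseteq> E\<close> unfolding p_system_def by blast
  also have "\<dots> \<le> p * real (card B)"
  proof (intro mult_left_mono)
    show "real (lower_rank F A) \<le> real (card B)"
      unfolding lower_rank_def using fin B by (simp add: Min_le)
  qed fact
  finally show ?thesis .
qed

section \<open>Marginal values\<close>

lemma marginal_antimono: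
  assumes "submodular_on E f" "mono_on (Pow E) f" "A \<subseteq> B" "B \<subseteq> E" "e \<in> E"
  shows "marginal f B e \<le> marginal f A e"
proof (cases "e \<in> B")
  case True
  then have "marginal f B e = 0" by (simp add: marginal_def insert_absorb)
  moreover have "f A \<le> f (A \<union> {e})"
    using assms by (intro mono_onD[OF assms(2)]) auto
  ultimately show ?thesis by (simp add: marginal_def)
next
  case False
  have "f ((A \<union> {e}) \<union> B) + f ((A \<union> {e}) \<inter> B) \<le> f (A \<union> {e}) + f B"
    using assms(1)[unfolded submodular_on_def, rule_format, of "A \<union> {e}" B] assms(3-5) by blast
  moreover have "(A \<union> {e}) \<union> B = B \<union> {e}" "(A \<union> {e}) \<inter> B = A" using False assms(3) by auto
  ultimately show ?thesis by (simp add: marginal_def)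
qed

text \<open>
  Curvature is measured against \<open>f {e}\<close> and not against the marginal value at \<open>{}\<close>; the two
  differ by \<open>f {} \<ge> 0\<close>, which goes in the favourable direction.
\<close>

lemma marginal_le_singleton:
  assumes "submodular_on E f" "mono_on (Pow E) f" "f {} \<ge> 0" "A \<subseteq> E" "e \<in> E"
  shows "marginal f A e \<le> f {e}"
  using marginal_antimono[OF assms(1,2), of "{}" A e] assms(3-5) by (simp add: marginal_def)

lemma submodular_union_le:
  assumes "finite T" "submodular_on E f" "mono_on (Pow E) f" "A \<subseteq> E" "T \<subseteq> E"
  shows "f (A \<union> T) \<le> f A + (\<Sum>t\<in>T. marginal f A t)"
  using assms(1,5)
proof (induction T rule: finite_induct)
  case (insert t T)
  have "marginal f (A \<union> T) t \<le> marginal f A t"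
    using insert.prems assms by (intro marginal_antimono) auto
  then show ?case using insert by (simp add: marginal_def)
qed simp

lemma curvature_union_ge:
  assumes "finite T" "has_curvature E f \<kappa>" "A \<subseteq> E" "T \<subseteq> E" "A \<inter> T = {}"
  shows "f (A \<union> T) \<ge> f A + (1 - \<kappa>) * (\<Sum>t\<in>T. f {t})"
  using assms(1,4,5)
proof (induction T rule: finite_induct)
  case (insert t T)
  have "marginal f (A \<union> T) t \<ge> (1 - \<kappa>) * f {t}"
    using insert assms(2,3) unfolding has_curvature_def by auto
  then show ?case using insert by (simp add: marginal_def distrib_left)
qed simp

section \<open>The weights of a greedy run\<close>

text \<open>
  The last conjunct is the partially performed Abel summation: \<open>\<theta>\<close> stands for the weight of the
  element that is examined next, so that only the excess of the earlier weights over it has been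
  accounted for. At the end of the run, \<open>\<theta> = 0\<close> yields \<open>w(Q) \<le> p * w(S)\<close>.
\<close>

definition greedy_certificate ::
    "real \<Rightarrow> 'a set \<Rightarrow> 'a set set \<Rightarrow> ('a set \<Rightarrow> real) \<Rightarrow> 'a set \<Rightarrow> 'a set \<Rightarrow> ('a \<Rightarrow> real) \<Rightarrow> bool" where
  "greedy_certificate p E F f S N w \<longleftrightarrow>
     N \<subseteq> E \<and> basis_of F (E - N) S \<and>
     (\<forall>x\<in>N. \<forall>y\<in>E - N. marginal f S x \<le> w y) \<and>
     (\<forall>y\<in>E - N. 0 \<le> w y \<and> marginal f S y \<le> w y) \<and>
     (\<forall>y\<in>S. w y \<le> f {y}) \<and>
     sum w S = f S - f {} \<and>
     (\<forall>Q\<in>F. \<forall>\<theta>. (\<forall>y\<in>E - N. \<theta> \<le> w y) \<longrightarrow>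
        (\<Sum>x\<in>Q - N. w x - \<theta>) \<le> p * (\<Sum>x\<in>S. w x - \<theta>))"

locale monotone_submodular_p_system =
  fixes E :: "'a set" and F :: "'a set set" and f :: "'a set \<Rightarrow> real" and p :: real
  assumes p_ge_1: "p \<ge> 1"
    and p_system: "p_system p E F"
    and f_empty: "f {} \<ge> 0"
    and mono: "mono_on (Pow E) f"
    and submodular: "submodular_on E f"
begin

lemma finite_E: "finite E" and F_Pow: "F \<subseteq> Pow E"
  and F_subset: "\<And>A B. A \<in> F \<Longrightarrow> B \<subseteq> A \<Longrightarrow> B \<in> F"
  and F_empty: "{} \<in> F"
  using p_system unfolding p_system_def indep_system_def by auto

lemma certificate_initial: "greedy_certificate p E F f {} E (\<lambda>_. 0)"
proof -
  have "\<forall>Q\<in>F. card (Q - E) = 0" using F_Pow by (auto simp: Diff_eq_empty_iff[THEN iffD2])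
  then show ?thesis using F_empty by (simp add: greedy_certificate_def basis_of_def)
qed

text \<open>
  For the summation conjunct, let \<open>\<mu>\<close> be the weight of the new element \<open>m\<close>. Lowering the
  threshold from \<open>\<mu>\<close> to \<open>\<theta>\<close> adds \<open>\<mu> - \<theta>\<close> for each examined element of \<open>Q\<close> on the left, and for
  each element of the solution on the right; the numbers of these compare with factor \<open>p\<close>, because
  the solution is a basis of the examined set. At threshold \<open>\<mu>\<close>, the element \<open>m\<close> itself
  contributes nothing.
\<close>

lemma certificate_step:
  assumes cert: "greedy_certificate p E F f S N w"
    and m: "is_arg_max (marginal f S) (\<lambda>x. x \<in> N) m"
  defines "S' \<equiv> if S \<union> {m} \<in> F then S \<union> {m} else S"
  shows "greedy_certificate p E F f S' (N - {m}) (w(m := marginal f S m))"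
proof -
  define \<mu> where "\<mu> = marginal f S m"
  define w' where "w' = w(m := \<mu>)"
  have mN: "m \<in> N" and best: "\<And>x. x \<in> N \<Longrightarrow> marginal f S x \<le> \<mu>"
    using m unfolding is_arg_max_def \<mu>_def by (auto simp: not_less)
  have NE: "N \<subseteq> E" and basis: "basis_of F (E - N) S"
    and le_old: "\<And>x y. x \<in> N \<Longrightarrow> y \<in> E - N \<Longrightarrow> marginal f S x \<le> w y"
    and old: "\<And>y. y \<in> E - N \<Longrightarrow> 0 \<le> w y \<and> marginal f S y \<le> w y"
    and single: "\<And>y. y \<in> S \<Longrightarrow> w y \<le> f {y}"
    and total: "sum w S = f S - f {}"
    and abel: "\<And>Q \<theta>. Q \<in> F \<Longrightarrow> (\<And>y. y \<in> E - N \<Longrightarrow> \<theta> \<le> w y) \<Longrightarrow>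
                 (\<Sum>x\<in>Q - N. w x - \<theta>) \<le> p * (\<Sum>x\<in>S. w x - \<theta>)"
    using cert unfolding greedy_certificate_def by auto
  have mE: "m \<in> E" using mN NE by blast
  have SE: "S \<subseteq> E - N" using basis unfolding basis_of_def by blast
  then have mS: "m \<notin> S" and finS: "finite S"
    using mN finite_E by (auto intro: finite_subset)
  have P': "E - (N - {m}) = insert m (E - N)" using mE by blast
  have basis': "basis_of F (E - (N - {m})) S'"
    unfolding P' S'_def using F_subset basis mN by (intro basis_of_insert) auto
  have S'E: "S' \<subseteq> E" and SS': "S \<subseteq> S'" and finS': "finite S'"
    using SE mE finS unfolding S'_def by auto
  have anti: "marginal f S' x \<le> marginal f S x" if "x \<in> E" for x
    using marginal_antimono[OF submodular mono SS' S'E that] .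
  have \<mu>_nonneg: "0 \<le> \<mu>"
    using mono_onD[OF mono, of S "S \<union> {m}"] SE mE by (auto simp: \<mu>_def marginal_def)
  have w'_eq: "w' y = w y" if "y \<noteq> m" for y using that by (simp add: w'_def)
  have w'_m: "w' m = \<mu>" by (simp add: w'_def)
  have \<mu>_le: "\<mu> \<le> w' y" if "y \<in> E - (N - {m})" for y
    using that le_old[OF mN] w'_eq[of y] w'_m unfolding P' \<mu>_def by (cases "y = m") auto
  have "marginal f S' x \<le> w' y" if "x \<in> N - {m}" "y \<in> E - (N - {m})" for x y
  proof -
    have "marginal f S' x \<le> marginal f S x" using that NE by (intro anti) auto
    also have "\<dots> \<le> \<mu>" using best that by blast
    also have "\<dots> \<le> w' y" using \<mu>_le that by blast
    finally show ?thesis .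
  qed
  moreover have "0 \<le> w' y \<and> marginal f S' y \<le> w' y" if "y \<in> E - (N - {m})" for y
  proof
    show "0 \<le> w' y" using \<mu>_nonneg \<mu>_le[OF that] by linarith
    have "marginal f S y \<le> w' y"
      using that old[of y] w'_eq[of y] w'_m unfolding P' \<mu>_def by (cases "y = m") auto
    then show "marginal f S' y \<le> w' y" using anti[of y] that by auto
  qed
  moreover have "w' y \<le> f {y}" if "y \<in> S'" for y
  proof (cases "y = m")
    case True
    then show ?thesis
      using marginal_le_singleton[OF submodular mono f_empty _ mE, of S] SE w'_m
      by (auto simp: \<mu>_def)
  next
    case False
    then have "y \<in> S" using that by (auto simp: S'_def split: if_splits)
    then show ?thesis using single w'_eq[OF False] by simp
  qed
  moreover have sumS: "sum w' S = sum w S"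
    using mS by (intro sum.cong) (auto simp: w'_def)
  then have "sum w' S' = f S' - f {}"
    using total mS finS w'_m by (auto simp: S'_def \<mu>_def marginal_def)
  moreover have "(\<Sum>x\<in>Q - (N - {m}). w' x - \<theta>) \<le> p * (\<Sum>x\<in>S'. w' x - \<theta>)"
    if Q: "Q \<in> F" and \<theta>: "\<forall>y\<in>E - (N - {m}). \<theta> \<le> w' y" for Q \<theta>
  proof -
    let ?Q = "Q - (N - {m})"
    have QE: "Q \<subseteq> E" using Q F_Pow by blast
    then have finQ: "finite Q" using finite_E finite_subset by blast
    have \<theta>\<mu>: "\<theta> \<le> \<mu>" using \<theta> w'_m mE P' by auto
    have "(\<Sum>x\<in>?Q. w' x - \<mu>) = (\<Sum>x\<in>Q - N. w' x - \<mu>)"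
      using finQ w'_m by (intro sum.mono_neutral_right) auto
    also have "\<dots> = (\<Sum>x\<in>Q - N. w x - \<mu>)"
      using mN by (intro sum.cong) (auto simp: w'_def)
    also have "\<dots> \<le> p * (\<Sum>x\<in>S. w x - \<mu>)"
      using abel[OF Q] le_old[OF mN] by (simp add: \<mu>_def)
    also have "(\<Sum>x\<in>S. w x - \<mu>) = (\<Sum>x\<in>S. w' x - \<mu>)"
      using sumS by (simp add: sum_subtractf)
    also have "\<dots> = (\<Sum>x\<in>S'. w' x - \<mu>)"
      using finS mS w'_m by (simp add: S'_def)
    finally have at_\<mu>: "(\<Sum>x\<in>?Q. w' x - \<mu>) \<le> p * (\<Sum>x\<in>S'. w' x - \<mu>)" .
    have "real (card ?Q) \<le> p * real (card S')"
      using p_ge_1 Q QE F_subset[OF Q, of ?Q] basis'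
      by (intro p_system_card_le[OF p_system, of "E - (N - {m})"]) auto
    then have count: "(\<mu> - \<theta>) * real (card ?Q) \<le> (\<mu> - \<theta>) * (p * real (card S'))"
      using \<theta>\<mu> by (intro mult_left_mono) auto
    have shift: "(\<Sum>x\<in>X. w' x - \<theta>) = (\<Sum>x\<in>X. w' x - \<mu>) + (\<mu> - \<theta>) * real (card X)" for X :: "'a set"
      by (simp add: sum_subtractf algebra_simps)
    show ?thesis
      using at_\<mu> count unfolding shift[of ?Q] shift[of S'] by (simp add: algebra_simps)
  qed
  ultimately show ?thesis
    using NE basis' unfolding greedy_certificate_def w'_def \<mu>_def by blast
qed

lemma certificate_reachable:
  assumes "(greedy_step F f)\<^sup>*\<^sup>* ({}, E) (S, N)"
  shows "\<exists>w. greedy_certificate p E F f S N w"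
  using assms
proof (induction "(S, N)" arbitrary: S N rule: rtranclp_induct)
  case base
  then show ?case using certificate_initial by blast
next
  case (step y)
  obtain S0 N0 where y: "y = (S0, N0)" by (cases y)
  then obtain w where "greedy_certificate p E F f S0 N0 w" using step.hyps(3) by blast
  then show ?case
    using step.hyps(2) unfolding y by (auto elim!: greedy_step.cases dest: certificate_step)
qed

text \<open>
  Stopping early at a maximal solution is harmless: were the examination continued, every remaining
  element would be rejected.
\<close>

lemma certificate_exhaust:
  assumes "maximal_in F S" "greedy_certificate p E F f S N w"
  shows "\<exists>w. greedy_certificate p E F f S {} w"
proof -
  have "finite N"
    using assms(2) finite_E unfolding greedy_certificate_def by (meson finite_subset)
  then show ?thesis using assms(2)
  proof (induction N arbitrary: w rule: finite_psubset_induct)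
    case (psubset N)
    show ?case
    proof (cases "N = {}")
      case True
      then show ?thesis using psubset.prems by blast
    next
      case False
      then have "Max (marginal f S ` N) \<in> marginal f S ` N"
        using psubset.hyps by (intro Max_in) auto
      then obtain m where "m \<in> N" "marginal f S m = Max (marginal f S ` N)" by auto
      then have m: "is_arg_max (marginal f S) (\<lambda>x. x \<in> N) m"
        using psubset.hyps by (simp add: is_arg_max_linorder)
      have "(if S \<union> {m} \<in> F then S \<union> {m} else S) = S"
        using assms(1) unfolding maximal_in_def by auto
      then have "greedy_certificate p E F f S (N - {m}) (w(m := marginal f S m))"
        using certificate_step[OF psubset.prems m] by simp
      moreover have "N - {m} \<subset> N" using m unfolding is_arg_max_def by blast
      ultimately show ?thesis using psubset.IH by blast
    qed
  qed
qed

lemma certificate_greedy_output: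
  assumes "greedy_output E F f S"
  obtains w where "greedy_certificate p E F f S {} w"
  using assms certificate_reachable certificate_exhaust unfolding greedy_output_def by metis

section \<open>From the weights to the objective\<close>

lemma certificate_bound:
  assumes cert: "greedy_certificate p E F f S {} w"
    and curv: "has_curvature E f \<kappa>" and Q: "Q \<in> F"
  shows "f Q \<le> (p + \<kappa>) * f S"
proof -
  have \<kappa>: "0 \<le> \<kappa>" "\<kappa> \<le> 1" using curv unfolding has_curvature_def by auto
  have SE: "S \<subseteq> E" and QE: "Q \<subseteq> E"
    using cert Q F_Pow unfolding greedy_certificate_def basis_of_def by auto
  then have fin: "finite S" "finite Q" using finite_E finite_subset by blast+
  have dom: "\<And>y. y \<in> E \<Longrightarrow> 0 \<le> w y \<and> marginal f S y \<le> w y"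
    and single: "\<And>y. y \<in> S \<Longrightarrow> w y \<le> f {y}"
    and total: "sum w S = f S - f {}"
    and linear: "sum w Q \<le> p * sum w S"
    using cert Q unfolding greedy_certificate_def by (auto dest!: bspec[of F _ Q] spec[of _ "0::real"])
  have "f Q + (1 - \<kappa>) * sum w (S - Q) \<le> f Q + (1 - \<kappa>) * (\<Sum>s\<in>S - Q. f {s})"
    using \<kappa> single by (intro add_left_mono mult_left_mono sum_mono) auto
  also have "\<dots> \<le> f (Q \<union> (S - Q))"
    using fin SE QE by (intro curvature_union_ge[OF _ curv]) auto
  also have "Q \<union> (S - Q) = S \<union> (Q - S)" by blast
  also have "f (S \<union> (Q - S)) \<le> f S + (\<Sum>t\<in>Q - S. marginal f S t)"
    using fin SE QE by (intro submodular_union_le[OF _ submodular mono]) auto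
  also have "\<dots> \<le> f S + sum w (Q - S)"
    using dom QE by (intro add_left_mono sum_mono) auto
  finally have compare: "f Q + (1 - \<kappa>) * sum w (S - Q) \<le> f S + sum w (Q - S)" .
  have splitS: "sum w (S - Q) = sum w S - sum w (S \<inter> Q)"
    and splitQ: "sum w (Q - S) = sum w Q - sum w (S \<inter> Q)"
    using fin sum.Int_Diff[of S w Q] sum.Int_Diff[of Q w S] by (auto simp: Int_commute)
  have "0 \<le> sum w (S \<inter> Q)" using dom SE by (intro sum_nonneg) auto
  (* Extending both differences to all of S and Q changes the bound by \<kappa> * w(S \<inter> Q). *)
  then have common: "0 \<le> \<kappa> * sum w (S \<inter> Q)" using \<kappa> by simp
  (* The weights of S sum to f S - f {}, so a multiple of f {} is left over. *)
  have "0 \<le> (p + \<kappa> - 1) * f {}" using p_ge_1 \<kappa> f_empty by simp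
  then show ?thesis
    using compare common linear unfolding splitS splitQ total by (simp add: algebra_simps)
qed

end

theorem mainTheorem1:
  fixes E :: "'a set" and F :: "'a set set" and f :: "'a set \<Rightarrow> real"
    and p \<kappa> :: real and S :: "'a set"
  assumes "p \<ge> 1"
    and "p_system p E F"
    and "\<forall>A. A \<subseteq> E \<longrightarrow> f A \<ge> 0"
    and "mono_on (Pow E) f"
    and "submodular_on E f"
    and "has_curvature E f \<kappa>"
    and "greedy_output E F f S"
  shows "S \<in> F \<and> f S \<ge> 1 / (p + \<kappa>) * Max (f ` F)"
proof -
  interpret monotone_submodular_p_system E F f p
    using assms by unfold_locales auto
  obtain w where cert: "greedy_certificate p E F f S {} w"
    using certificate_greedy_output[OF assms(7)] .
  have "finite F" using finite_E F_Pow by (simp add: finite_subset)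
  then have "Max (f ` F) \<le> (p + \<kappa>) * f S"
    using certificate_bound[OF cert assms(6)] F_empty by (subst Max_le_iff) auto
  moreover have "p + \<kappa> > 0" using assms(1,6) unfolding has_curvature_def by linarith
  ultimately have "1 / (p + \<kappa>) * Max (f ` F) \<le> f S" by (simp add: field_simps)
  moreover have "S \<in> F" using cert unfolding greedy_certificate_def basis_of_def by blast
  ultimately show ?thesis by blast
qed

end
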